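(* Let $I=[a,b]$ with $a<b$ be a compact real interval. For any circuit $f\colon I\to\mathbb{R}^2$, the complement $\mathbb{R}^2\setminus f[I]$ is disconnected.
   Context: The plane $\mathbb{R}^2$ carries the Euclidean metric, and $f[I]=\{f(x) : x\in I\}$ is the image of $f$. A circuit is a continuous map $f\colon I=[a,b]\to\mathbb{R}^2$ such that, for $x\neq y$ in $I$, one has $f(x)=f(y)$ if and only if $\{x,y\}=\{a,b\}$. A subset $X$ of a metric space $M$ is disconnected if there exist open sets $A,B\subset M$ with $A\cup B\supset X$, $A\cap X\neq\emptyset\neq B\cap X$ and $A\cap B\cap X=\emptyset$; otherwise $X$ is connected. *)

theory Defs
  imports "HOL-Analysis.Analysis"
begin

(* Only the restriction of f to {a..b} matters. *)
definition circuit :: "real \<Rightarrow> real \<Rightarrow> (real \<Rightarrow> real ^ 2) \<Rightarrow> bool" where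
  "circuit a b f \<longleftrightarrow>
     continuous_on {a..b} f \<and>
     (\<forall>x\<in>{a..b}. \<forall>y\<in>{a..b}. x \<noteq> y \<longrightarrow> (f x = f y \<longleftrightarrow> {x, y} = {a, b}))"

end

theory Submission
  imports Defs
begin

text \<open>
  The image of a circuit is a topological circle: gluing the endpoints of an interval gives a
  circle, and a continuous injection from a compact space into a Hausdorff space is an embedding.
  The Jordan--Brouwer separation theorem says that a subset of Euclidean space homeomorphic to
  its unit sphere has disconnected complement. A circle is the unit sphere exactly in dimension two,
  and this is where the plane enters. What has to be supplied is that a circuit, once its
  parameter interval is rescaled to the unit interval, is a closed simple path, so that the
  homeomorphism with a circle is at hand.
\<close>

lemma circuit_rescaled_simple_loop:
  assumes "a < b" and "circuit a b f"
  defines "c \<equiv> \<lambda>t. f ((b - a) * t + a)"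
  shows "simple_path c" and "pathfinish c = pathstart c" and "path_image c = f ` {a..b}"
proof -
  have cont: "continuous_on {a..b} f"
    and inj: "\<And>x y. \<lbrakk>x \<in> {a..b}; y \<in> {a..b}; x \<noteq> y\<rbrakk> \<Longrightarrow> f x = f y \<longleftrightarrow> {x, y} = {a, b}"
    using assms(2) by (auto simp: circuit_def)
  have img: "(\<lambda>t. (b - a) * t + a) ` {0..1} = {a..b}"
    using assms(1) by (simp add: image_affinity_atLeastAtMost)
  show "path_image c = f ` {a..b}"
    unfolding path_image_def c_def img[symmetric] by (simp add: image_image)
  show "pathfinish c = pathstart c"
    using inj[of a b] assms(1) by (simp add: pathfinish_def pathstart_def c_def)
  have "path c"
    unfolding path_def c_def
    by (rule continuous_on_compose2[OF cont]) (auto intro!: continuous_intros simp: img)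
  moreover have "loop_free c"
    unfolding loop_free_def
  proof (intro ballI impI)
    fix s t :: real
    assume st: "s \<in> {0..1}" "t \<in> {0..1}" and eq: "c s = c t"
    show "s = t \<or> s = 0 \<and> t = 1 \<or> s = 1 \<and> t = 0"
    proof (cases "s = t")
      case False
      then have "{(b - a) * s + a, (b - a) * t + a} = {a, b}"
        using inj st eq img assms(1) unfolding c_def
        by (metis (no_types, lifting) add_right_cancel diff_gt_0_iff_gt image_eqI
            less_irrefl mult_cancel_left)
      \<comment> \<open>Inverting the rescaling, the parameters \<open>a\<close> and \<open>b\<close> come from \<open>0\<close> and \<open>1\<close>.\<close>
      moreover have "(b - a) * r + a = a \<longleftrightarrow> r = 0" "(b - a) * r + a = b \<longleftrightarrow> r = 1" for r
        using assms(1) mult_cancel_left[of "b - a" r 1] by (auto simp: eq_diff_eq[symmetric])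
      ultimately show ?thesis
        by (auto simp: doubleton_eq_iff)
    qed simp
  qed
  ultimately show "simple_path c"
    by (simp add: simple_path_def)
qed

theorem theorem1p2:
  fixes a b :: real and f :: "real \<Rightarrow> real ^ 2"
  assumes "a < b" and "circuit a b f"
  shows "\<not> connected (UNIV - f ` {a..b})"
proof -
  note loop = circuit_rescaled_simple_loop[OF assms]
  have "f ` {a..b} homeomorphic sphere (0::complex) 1"
    using homeomorphic_simple_path_image_circle[OF loop(1,2), of 1 0] by (simp add: loop(3))
  also have "sphere (0::complex) 1 homeomorphic sphere (0::real^2) 1"
    by (rule homeomorphic_spheres_gen) auto
  finally have "f ` {a..b} homeomorphic sphere (0::real^2) 1" .
  then show ?thesis
    using Jordan_Brouwer_separation[of "f ` {a..b}" 0 1] by (simp add: Compl_eq_Diff_UNIV)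
qed

end
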